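(* Let $\theta_k$ be generated by the stochastic iteration $\theta_{k+1}=\theta_k-\alpha B^{-1}g_k(\theta_k)$ with constant step-size $\alpha>0$ while optimizing the quadratic objective $h(\theta)=\frac12(\theta-\theta^* )^\top H^*(\theta-\theta^* )$, under the assumptions given in the context. Suppose that $\alpha\lambda_1(B^{-1}H^* )<1$ and define $\bar\theta_k=\frac{1}{k+1}\sum_{i=0}^k\theta_i$. Then $$\mathrm{E}[h(\bar\theta_k)]-h(\theta^* )\le\min\left\{\frac{1}{2(k+1)}\operatorname{tr}\left({H^*}^{-1}\Sigma_g\right),\ \frac{\alpha}{4}\operatorname{tr}\left(\left(B-\frac{\alpha}{2}H^*\right)^{-1}\Sigma_g\right)\right\}$$ $$\qquad+\min\left\{\frac{1}{2(k+1)^2\alpha^2}\left\|{H^*}^{-1/2}B(\theta_0-\theta^* )\right\|^2,\ \frac{1}{2(k+1)\alpha}\left\|B^{1/2}(\theta_0-\theta^* )\right\|^2,\ h(\theta_0)\right\}.$$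
   Context: $H^*$ and $B$ are fixed real symmetric positive definite $n\times n$ matrices, $\theta^*\in\mathbb{R}^n$, and $\theta_0\in\mathbb{R}^n$ is deterministic. The random vectors $g_k(\theta_k)$ satisfy: conditionally on the history $\theta_0,\dots,\theta_k$, the distribution of $g_k(\theta_k)$ depends only on $\theta_k$, with mean $\nabla h(\theta_k)=H^*(\theta_k-\theta^* )$ and covariance matrix $\Sigma_g$, a constant matrix not depending on $\theta_k$ or $k$. $\lambda_1(\cdot)$ is the largest eigenvalue, and $\|\cdot\|$ is the Euclidean norm. *)

theory Defs
  imports "HOL-Probability.Probability"
begin

definition sym_pos_def :: "real^'n^'n \<Rightarrow> bool" where
  "sym_pos_def A \<longleftrightarrow> transpose A = A \<and> (\<forall>x. x \<noteq> 0 \<longrightarrow> x \<bullet> (A *v x) > 0)"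

definition sym_pos_semidef :: "real^'n^'n \<Rightarrow> bool" where
  "sym_pos_semidef A \<longleftrightarrow> transpose A = A \<and> (\<forall>x. x \<bullet> (A *v x) \<ge> 0)"

text \<open>The principal square root, meaningful for symmetric positive semidefinite matrices, for which
  it exists and is unique.\<close>

definition matrix_sqrt :: "real^'n^'n \<Rightarrow> real^'n^'n" where
  "matrix_sqrt A = (THE S. sym_pos_semidef S \<and> S ** S = A)"

definition eigenvalues :: "real^'n^'n \<Rightarrow> real set" where
  "eigenvalues A = {l. \<exists>v. v \<noteq> 0 \<and> A *v v = l *\<^sub>R v}"

text \<open>Only real eigenvalues are taken into account. This is the largest eigenvalue whenever the
  spectrum is real, as it is for \<open>matrix_inv B ** H\<close> with \<open>B\<close> and \<open>H\<close> symmetric positive definite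
  (this product is similar to a symmetric matrix, but need not be symmetric itself).\<close>

definition lambda_max :: "real^'n^'n \<Rightarrow> real" where
  "lambda_max A = Max (eigenvalues A)"

definition quad_obj :: "real^'n^'n \<Rightarrow> real^'n \<Rightarrow> real^'n \<Rightarrow> real" where
  "quad_obj H \<theta>s \<theta> = 1/2 * ((\<theta> - \<theta>s) \<bullet> (H *v (\<theta> - \<theta>s)))"

text \<open>The \<open>\<sigma>\<close>-algebra generated by \<open>X 0, \<dots>, X k\<close>.\<close>

definition history :: "'a measure \<Rightarrow> (nat \<Rightarrow> 'a \<Rightarrow> real^'n) \<Rightarrow> nat \<Rightarrow> 'a measure" where
  "history M X k = sigma (space M) {X i -` A \<inter> space M | i A. i \<le> k \<and> A \<in> sets borel}"

definition cond_prob_alg :: "'a measure \<Rightarrow> 'a measure \<Rightarrow> 'a set \<Rightarrow> 'a \<Rightarrow> real" where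
  "cond_prob_alg M F E = real_cond_exp M F (indicator E)"

text \<open>Conditional mean and conditional covariance matrix of a square integrable random vector;
  they are determined only up to null sets.\<close>

definition cond_mean :: "'a measure \<Rightarrow> 'a measure \<Rightarrow> ('a \<Rightarrow> real^'n) \<Rightarrow> 'a \<Rightarrow> real^'n" where
  "cond_mean M F Y \<omega> = (\<chi> i. real_cond_exp M F (\<lambda>\<omega>. Y \<omega> $ i) \<omega>)"

definition cond_cov :: "'a measure \<Rightarrow> 'a measure \<Rightarrow> ('a \<Rightarrow> real^'n) \<Rightarrow> 'a \<Rightarrow> real^'n^'n" where
  "cond_cov M F Y \<omega> =
    (\<chi> i j. real_cond_exp M F
       (\<lambda>\<omega>. (Y \<omega> - cond_mean M F Y \<omega>) $ i * (Y \<omega> - cond_mean M F Y \<omega>) $ j) \<omega>)"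

definition iterate_avg :: "(nat \<Rightarrow> 'a \<Rightarrow> real^'n) \<Rightarrow> nat \<Rightarrow> 'a \<Rightarrow> real^'n" where
  "iterate_avg X k \<omega> = (1 / real (k + 1)) *\<^sub>R (\<Sum>i\<le>k. X i \<omega>)"

end

theory Submission
  imports Defs
begin

text \<open>\<open>B\<close> and \<open>H\<close> are diagonalised simultaneously: there are vectors \<open>v i\<close>, orthonormal for the inner
  product given by \<open>B\<close>, with \<open>H v\<^sub>i = l\<^sub>i B v\<^sub>i\<close>. In the coordinates \<open>v\<^sub>i \<bullet> B (\<theta> - \<theta>s)\<close> the iteration
  decouples into scalar recursions with contraction factor \<open>1 - \<alpha> l\<^sub>i \<in> (0, 1)\<close> and noise that is
  uncorrelated over time, so the expected objective at the averaged iterate is exactly a sum over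
  \<open>i\<close> of a variance and a bias term, both made of geometric sums. Every bound of the theorem is the
  sum over \<open>i\<close> of an elementary bound on a geometric sum: \<open>x * (\<Sum>m<r. (1 - x) ^ m) \<le> 1\<close>,
  \<open>(\<Sum>m<r. (1 - x) ^ m) \<le> r\<close>, or the Cauchy-Schwarz bound
  \<open>(\<Sum>m<r. (1 - x) ^ m)\<^sup>2 \<le> r / (x * (2 - x))\<close>.\<close>

subsection \<open>Simultaneous diagonalisation\<close>

lemma inner_matrix_symmetric:
  fixes A :: "real^'n^'n"
  assumes "transpose A = A"
  shows "x \<bullet> (A *v y) = (A *v x) \<bullet> y"
  by (metis assms dot_lmul_matrix transpose_matrix_vector)

lemma matrix_vector_sum_scaleR:
  fixes A :: "real^'n^'m"
  shows "A *v (\<Sum>i\<in>I. c i *\<^sub>R v i) = (\<Sum>i\<in>I. c i *\<^sub>R (A *v v i))"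
  by (simp add: linear_sum[OF matrix_vector_mul_linear] matrix_vector_mult_scaleR)

text \<open>Near \<open>t = 0\<close> the linear term dominates, so a nonzero \<open>a\<close> would
  produce a negative value. This is the first-order optimality condition used below along a line
  through an extremal point.\<close>

lemma quadratic_nonneg_imp_linear_coeff_zero:
  fixes a b :: real
  assumes nn: "\<And>t. 0 \<le> t * a + t\<^sup>2 * b"
  shows "a = 0"
proof (rule ccontr)
  assume a: "a \<noteq> 0"
  \<comment> \<open>The denominator makes \<open>t * a\<close> equal to
    \<open>- t\<^sup>2 * (1 + \<bar>b\<bar>)\<close>, which outweighs the quadratic term whatever
    the sign of \<open>b\<close>.\<close>
  define t where "t = - a / (1 + \<bar>b\<bar>)"
  have p: "1 + \<bar>b\<bar> > 0" by simp
  have "t * a = - (t * t * (1 + \<bar>b\<bar>))" using p by (simp add: t_def)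
  then have "t * a + t\<^sup>2 * b = - (t\<^sup>2 * (1 + \<bar>b\<bar> - b))"
    unfolding power2_eq_square by (simp only:) (simp add: algebra_simps)
  also have "\<dots> < 0"
    using a p by (auto simp: t_def intro!: mult_pos_pos)
  finally show False using nn[of t] by linarith
qed

section \<open>Positive definite matrices and inverses\<close>

lemma sym_pos_def_posD: "sym_pos_def A \<Longrightarrow> x \<noteq> 0 \<Longrightarrow> 0 < x \<bullet> (A *v x)"
  and sym_pos_def_symD: "sym_pos_def A \<Longrightarrow> transpose A = A"
  by (auto simp: sym_pos_def_def)

lemma sym_pos_def_imp_semidef: "sym_pos_def A \<Longrightarrow> sym_pos_semidef A"
  unfolding sym_pos_def_def sym_pos_semidef_def
  by (metis inner_zero_left less_eq_real_def)

lemma invertible_iff_ker: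
  fixes A :: "real^'n^'n"
  shows "invertible A \<longleftrightarrow> (\<forall>x. A *v x = 0 \<longrightarrow> x = 0)"
  by (simp add: invertible_left_inverse matrix_left_invertible_ker)

lemma sym_pos_def_invertible: "sym_pos_def A \<Longrightarrow> invertible A"
  unfolding invertible_iff_ker
  by (metis inner_zero_right less_irrefl sym_pos_def_posD)

text \<open>\<open>matrix_inv\<close> is a choice among two-sided inverses. A one-sided inverse of a
  square matrix is two-sided, and two-sided inverses are unique, so the choice is forced.\<close>

lemma matrix_inv_eqI:
  fixes A C :: "real^'n^'n"
  assumes AC: "A ** C = mat 1"
  shows "matrix_inv A = C"
proof -
  have CA: "C ** A = mat 1" using AC by (simp add: matrix_left_right_inverse)
  have "A ** matrix_inv A = mat 1 \<and> matrix_inv A ** A = mat 1"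
    unfolding matrix_inv_def by (rule someI[of _ C]) (use AC CA in blast)
  then show ?thesis
    by (metis CA matrix_mul_assoc matrix_mul_lid matrix_mul_rid)
qed

lemma matrix_inv_vector:
  fixes A :: "real^'n^'n"
  assumes "invertible A"
  shows "A *v (matrix_inv A *v x) = x" and "matrix_inv A *v (A *v x) = x"
proof -
  obtain C where "A ** C = mat 1" "C ** A = mat 1"
    using assms by (auto simp: invertible_def)
  moreover from this have "matrix_inv A = C" by (intro matrix_inv_eqI)
  ultimately show "A *v (matrix_inv A *v x) = x" and "matrix_inv A *v (A *v x) = x"
    by (simp_all add: matrix_vector_mul_assoc)
qed

text \<open>A maximiser of the Rayleigh quotient on the \<open>B\<close>-orthogonal complement of the eigenvectors
  already found is a further eigenvector.\<close>

lemma generalized_eigenvector_step: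
  fixes H B :: "real^'n^'n" and v :: "'n \<Rightarrow> real^'n"
  assumes H: "transpose H = H" and B: "sym_pos_def B"
    and I: "I \<noteq> UNIV"
    and on: "\<And>i j. i \<in> I \<Longrightarrow> j \<in> I \<Longrightarrow> v i \<bullet> (B *v v j) = (if i = j then 1 else 0)"
    and ev: "\<And>i. i \<in> I \<Longrightarrow> H *v v i = l i *\<^sub>R (B *v v i)"
  obtains w m where "w \<bullet> (B *v w) = 1" "\<And>i. i \<in> I \<Longrightarrow> v i \<bullet> (B *v w) = 0"
    "H *v w = m *\<^sub>R (B *v w)"
proof -
  note symB = sym_pos_def_symD[OF B]
  define W where "W = {x. \<forall>i\<in>I. v i \<bullet> (B *v x) = 0}"
  \<comment> \<open>The Rayleigh quotient is invariant under scaling, so its supremum over the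
    nonzero vectors of \<open>W\<close> is attained on this compact set. Normalisation with respect
    to \<open>B\<close> is postponed to the end.\<close>
  define S where "S = W \<inter> sphere 0 1"
  have W_lin: "x + t *\<^sub>R y \<in> W" if "x \<in> W" "y \<in> W" for x y t
    using that by (simp add: W_def matrix_vector_right_distrib matrix_vector_mult_scaleR inner_right_distrib)
  have W_scale: "t *\<^sub>R x \<in> W" if "x \<in> W" for x t
    using that by (simp add: W_def matrix_vector_mult_scaleR)
  have cont: "continuous_on A (\<lambda>x. C *v x)" for A and C :: "real^'n^'n"
    by (rule matrix_vector_mult_linear_continuous_on)
  have "W = (\<Inter>i\<in>I. {x. v i \<bullet> (B *v x) = 0})" by (auto simp: W_def)
  moreover have "closed {x. v i \<bullet> (B *v x) = 0}" for i
    by (intro closed_Collect_eq continuous_intros cont)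
  ultimately have "closed W" by auto
  then have "compact S" unfolding S_def by (intro closed_Int_compact) auto
  \<comment> \<open>A dimension count shows that \<open>S\<close> is nonempty: the vectors
    \<open>B *v v i\<close> are too few to span the space, and a vector orthogonal to all of them
    lies in \<open>W\<close> because \<open>B\<close> is symmetric.\<close>
  have "card I < CARD('n)"
    using I by (simp add: psubset_card_mono psubset_eq)
  have "dim ((\<lambda>i. B *v v i) ` I) \<le> card ((\<lambda>i. B *v v i) ` I)"
    by (simp add: dim_le_card')
  also have "\<dots> \<le> card I" by (simp add: card_image_le)
  also have "\<dots> < DIM(real^'n)" using \<open>card I < CARD('n)\<close> by simp
  finally obtain x0 where x0: "x0 \<noteq> 0" "\<And>y. y \<in> span ((\<lambda>i. B *v v i) ` I) \<Longrightarrow> orthogonal x0 y"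
    using orthogonal_to_subspace_exists by blast
  have "x0 \<in> W"
  proof -
    have "x0 \<bullet> (B *v v i) = 0" if "i \<in> I" for i
      using x0(2)[of "B *v v i"] that by (simp add: orthogonal_def span_base)
    moreover have "v i \<bullet> (B *v x0) = x0 \<bullet> (B *v v i)" for i
      using inner_matrix_symmetric[OF symB, of "v i" x0] by (simp only: inner_commute)
    ultimately show ?thesis by (simp add: W_def)
  qed
  then have "(1 / norm x0) *\<^sub>R x0 \<in> S"
    using x0(1) W_scale by (simp add: S_def)
  then have "S \<noteq> {}" by blast
  have Bpos: "0 < x \<bullet> (B *v x)" if "x \<in> S" for x
    using that by (intro sym_pos_def_posD[OF B]) (auto simp: S_def)
  have "continuous_on S (\<lambda>x. (x \<bullet> (H *v x)) / (x \<bullet> (B *v x)))"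
    by (intro continuous_intros cont ballI) (metis Bpos less_irrefl)
  from continuous_attains_sup[OF \<open>compact S\<close> \<open>S \<noteq> {}\<close> this]
  obtain w where w: "w \<in> S" and
    sup: "\<And>x. x \<in> S \<Longrightarrow> (x \<bullet> (H *v x)) / (x \<bullet> (B *v x)) \<le> (w \<bullet> (H *v w)) / (w \<bullet> (B *v w))"
    by blast
  define m where "m = (w \<bullet> (H *v w)) / (w \<bullet> (B *v w))"
  \<comment> \<open>With \<open>m\<close> the maximal quotient, maximality says that the quadratic
    form of \<open>A\<close> is nonnegative on \<open>W\<close> and vanishes at \<open>w\<close>.
    The claim to reach is \<open>A *v w = 0\<close>.\<close>
  define A where "A = m *\<^sub>R B - H"
  have Av: "A *v x = m *\<^sub>R (B *v x) - H *v x" for x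
    by (simp add: A_def matrix_vector_mult_diff_rdistrib scaleR_matrix_vector_assoc)
  have A_sym: "x \<bullet> (A *v y) = (A *v x) \<bullet> y" for x y
    by (simp add: Av inner_diff_left inner_diff_right inner_matrix_symmetric[OF symB]
        inner_matrix_symmetric[OF H])
  have wW: "w \<in> W" using w by (simp add: S_def)
  have Aww: "w \<bullet> (A *v w) = 0"
    using Bpos[OF w] by (simp add: Av inner_diff_right m_def)
  have A_nn: "0 \<le> x \<bullet> (A *v x)" if "x \<in> W" for x
  proof (cases "x = 0")
    case False
    define u where "u = (1 / norm x) *\<^sub>R x"
    have u: "u \<in> S" using False that W_scale by (simp add: S_def u_def)
    have "0 \<le> u \<bullet> (A *v u)"
      using sup[OF u] Bpos[OF u] by (simp add: Av inner_diff_right m_def[symmetric] pos_divide_le_eq)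
    also have "\<dots> = (x \<bullet> (A *v x)) / (norm x)\<^sup>2"
      by (simp add: u_def matrix_vector_mult_scaleR power2_eq_square)
    finally show ?thesis using False by (simp add: zero_le_divide_iff)
  qed simp
  \<comment> \<open>Since \<open>w\<close> minimises the form of \<open>A\<close> on the subspace
    \<open>W\<close>, its derivative at \<open>w\<close> vanishes in every direction
    \<open>x\<close> of \<open>W\<close>.\<close>
  have orthW: "x \<bullet> (A *v w) = 0" if "x \<in> W" for x
  proof -
    have "0 \<le> t * (2 * (x \<bullet> (A *v w))) + t\<^sup>2 * (x \<bullet> (A *v x))" for t
    proof -
      have "0 \<le> (w + t *\<^sub>R x) \<bullet> (A *v (w + t *\<^sub>R x))"
        by (intro A_nn W_lin wW that)
      also have "\<dots> = t * (2 * (x \<bullet> (A *v w))) + t\<^sup>2 * (x \<bullet> (A *v x))"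
        using A_sym[of w x] Aww
        by (simp add: matrix_vector_right_distrib matrix_vector_mult_scaleR inner_left_distrib
            inner_right_distrib inner_commute power2_eq_square distrib_left)
      finally show ?thesis .
    qed
    from quadratic_nonneg_imp_linear_coeff_zero[OF this] show ?thesis by simp
  qed
  \<comment> \<open>Symmetry moves \<open>H\<close> onto \<open>v i\<close>, where it acts as a
    multiple of \<open>B\<close>, so both parts of \<open>A\<close> vanish by the
    \<open>B\<close>-orthogonality of \<open>w\<close> to \<open>v i\<close>.\<close>
  have orthI: "v i \<bullet> (A *v w) = 0" if "i \<in> I" for i
  proof -
    have "v i \<bullet> (B *v w) = 0" using wW that by (simp add: W_def)
    moreover have "v i \<bullet> (H *v w) = l i * (v i \<bullet> (B *v w))"
      using ev[OF that] by (simp add: inner_matrix_symmetric[OF H] inner_matrix_symmetric[OF symB])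
    ultimately show ?thesis by (simp add: Av inner_diff_right)
  qed
  have "A *v w = 0"
  proof -
    define y where "y = A *v w"
    \<comment> \<open>This is the \<open>B\<close>-orthogonal projection of \<open>y\<close> to
      \<open>W\<close>. Hence \<open>y\<close> is a sum of a vector of \<open>W\<close> and a
      combination of the \<open>v i\<close>; being orthogonal to both, it is orthogonal to
      itself.\<close>
    define x where "x = y - (\<Sum>i\<in>I. (v i \<bullet> (B *v y)) *\<^sub>R v i)"
    have "x \<in> W"
    proof -
      have "v j \<bullet> (B *v x) = 0" if "j \<in> I" for j
      proof -
        have "v j \<bullet> (B *v x) = v j \<bullet> (B *v y) - (\<Sum>i\<in>I. (v i \<bullet> (B *v y)) * (v j \<bullet> (B *v v i)))"
          by (simp add: x_def matrix_vector_mult_diff_distrib matrix_vector_sum_scaleR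
              inner_diff_right inner_sum_right)
        also have "(\<Sum>i\<in>I. (v i \<bullet> (B *v y)) * (v j \<bullet> (B *v v i)))
            = (\<Sum>i\<in>I. if i = j then v j \<bullet> (B *v y) else 0)"
          using that by (intro sum.cong) (auto simp: on)
        also have "\<dots> = v j \<bullet> (B *v y)" using that by simp
        finally show ?thesis by simp
      qed
      then show ?thesis by (simp add: W_def)
    qed
    have "y \<bullet> y = x \<bullet> y + (\<Sum>i\<in>I. (v i \<bullet> (B *v y)) * (v i \<bullet> y))"
      by (simp add: x_def inner_diff_left inner_sum_left)
    also have "\<dots> = 0"
      using orthW[OF \<open>x \<in> W\<close>] orthI by (simp add: y_def)
    finally show ?thesis by (simp add: y_def)
  qed
  then have eig: "H *v w = m *\<^sub>R (B *v w)" by (simp add: Av)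
  define r where "r = 1 / sqrt (w \<bullet> (B *v w))"
  show thesis
  proof (rule that)
    show "(r *\<^sub>R w) \<bullet> (B *v (r *\<^sub>R w)) = 1"
      using Bpos[OF w] by (simp add: r_def matrix_vector_mult_scaleR field_simps)
    show "v i \<bullet> (B *v (r *\<^sub>R w)) = 0" if "i \<in> I" for i
      using W_scale[OF wW, of r] that by (auto simp: W_def)
    show "H *v (r *\<^sub>R w) = m *\<^sub>R (B *v (r *\<^sub>R w))"
      by (simp add: matrix_vector_mult_scaleR eig)
  qed
qed

section \<open>Bases of generalized eigenvectors\<close>

definition generalized_eigenbasis ::
    "real^'n^'n \<Rightarrow> real^'n^'n \<Rightarrow> ('n \<Rightarrow> real^'n) \<Rightarrow> ('n \<Rightarrow> real) \<Rightarrow> bool" where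
  "generalized_eigenbasis B H v l \<longleftrightarrow>
    (\<forall>i j. v i \<bullet> (B *v v j) = (if i = j then 1 else 0)) \<and>
    (\<forall>i. H *v v i = l i *\<^sub>R (B *v v i))"

text \<open>Induction over sets of indices, adding one eigenvector at a time. For
  \<open>B = mat 1\<close> this is the spectral theorem for symmetric matrices, which serves for the
  square roots below.\<close>

theorem generalized_eigenbasis_exists:
  fixes H B :: "real^'n^'n"
  assumes H: "transpose H = H" and B: "sym_pos_def B"
  obtains v l where "generalized_eigenbasis B H v l"
proof -
  have "\<exists>v l. (\<forall>i\<in>I. \<forall>j\<in>I. v i \<bullet> (B *v v j) = (if i = j then 1 else 0)) \<and>
      (\<forall>i\<in>I. H *v v i = l i *\<^sub>R (B *v v i))" for I :: "'n set"
  proof (induction I rule: finite_induct[OF finite])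
    case (2 a I)
    then obtain v l where on: "\<And>i j. i \<in> I \<Longrightarrow> j \<in> I \<Longrightarrow> v i \<bullet> (B *v v j) = (if i = j then 1 else 0)"
      and ev: "\<And>i. i \<in> I \<Longrightarrow> H *v v i = l i *\<^sub>R (B *v v i)" by blast
    have "I \<noteq> UNIV" using 2 by auto
    from generalized_eigenvector_step[OF H B this on ev]
    obtain w m where w: "w \<bullet> (B *v w) = 1" "\<And>i. i \<in> I \<Longrightarrow> v i \<bullet> (B *v w) = 0"
      "H *v w = m *\<^sub>R (B *v w)" by blast
    have "w \<bullet> (B *v v i) = 0" if "i \<in> I" for i
      using w(2)[OF that] by (metis inner_commute inner_matrix_symmetric sym_pos_def_symD[OF B])
    then show ?case
      using w on ev 2(2)
      by (intro exI[of _ "v(a := w)"] exI[of _ "l(a := m)"]) auto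
  qed auto
  from this[of UNIV] show thesis
    using that by (auto simp: generalized_eigenbasis_def)
qed

lemma generalized_eigenbasis_orthonormal:
  "generalized_eigenbasis B H v l \<Longrightarrow> v i \<bullet> (B *v v j) = (if i = j then 1 else 0)"
  and generalized_eigenbasis_eigen:
  "generalized_eigenbasis B H v l \<Longrightarrow> H *v v i = l i *\<^sub>R (B *v v i)"
  by (auto simp: generalized_eigenbasis_def)

text \<open>Put the vectors as columns into \<open>V\<close>. Orthonormality says that
  \<open>transpose V ** B\<close> is a left inverse of \<open>V\<close>; as the index type makes
  \<open>V\<close> square, it is also a right inverse, and that is the expansion.\<close>

lemma generalized_eigenbasis_expansion:
  fixes y :: "real^'n"
  assumes "generalized_eigenbasis B H v l"
  shows "y = (\<Sum>i\<in>UNIV. (v i \<bullet> (B *v y)) *\<^sub>R v i)"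
proof -
  define V :: "real^'n^'n" where "V = (\<chi> a i. v i $ a)"
  have V: "V *v x = (\<Sum>i\<in>UNIV. (x $ i) *\<^sub>R v i)" for x
    by (simp add: V_def vec_eq_iff matrix_vector_mult_def mult.commute)
  have VT: "transpose V *v x = (\<chi> i. v i \<bullet> x)" for x
    by (simp add: V_def vec_eq_iff matrix_vector_mult_def transpose_def inner_vec_def)
  have "((transpose V ** B) ** V) *v x = x" for x
  proof -
    have "((transpose V ** B) ** V) *v x = (\<chi> j. \<Sum>i\<in>UNIV. (x $ i) * (v j \<bullet> (B *v v i)))"
      by (simp only: matrix_vector_mul_assoc[symmetric] V VT matrix_vector_sum_scaleR)
        (simp add: vec_eq_iff)
    also have "\<dots> = x"
      by (simp add: vec_eq_iff generalized_eigenbasis_orthonormal[OF assms] if_distrib cong: if_cong)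
    finally show ?thesis .
  qed
  then have "(transpose V ** B) ** V = mat 1"
    by (metis matrix_eq matrix_vector_mul_lid)
  then have "V ** (transpose V ** B) = mat 1"
    by (simp add: matrix_left_right_inverse)
  then have "y = V *v (transpose V *v (B *v y))"
    by (simp only: matrix_vector_mul_assoc matrix_mul_assoc[symmetric] matrix_vector_mul_lid)
  also have "\<dots> = (\<Sum>i\<in>UNIV. (v i \<bullet> (B *v y)) *\<^sub>R v i)" by (simp only: V VT) simp
  finally show ?thesis .
qed

lemma generalized_eigenbasis_quadratic_form:
  assumes e: "generalized_eigenbasis B H v l"
  shows "x \<bullet> (H *v x) = (\<Sum>i\<in>UNIV. l i * (v i \<bullet> (B *v x))\<^sup>2)"
    and "x \<bullet> (B *v x) = (\<Sum>i\<in>UNIV. (v i \<bullet> (B *v x))\<^sup>2)"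
proof -
  define c where "c i = v i \<bullet> (B *v x)" for i
  have x: "x = (\<Sum>i\<in>UNIV. c i *\<^sub>R v i)"
    unfolding c_def by (rule generalized_eigenbasis_expansion[OF e])
  have "x \<bullet> (H *v x) = (\<Sum>j\<in>UNIV. \<Sum>i\<in>UNIV. c i * (c j * (l j * (v i \<bullet> (B *v v j)))))"
    by (subst (1 2) x) (simp add: matrix_vector_sum_scaleR inner_sum_left inner_sum_right
        generalized_eigenbasis_eigen[OF e] sum_distrib_left mult_ac)
  then show "x \<bullet> (H *v x) = (\<Sum>i\<in>UNIV. l i * (c i)\<^sup>2)"
    by (simp add: generalized_eigenbasis_orthonormal[OF e] if_distrib power2_eq_square mult_ac cong: if_cong)
  have "x \<bullet> (B *v x) = (\<Sum>j\<in>UNIV. \<Sum>i\<in>UNIV. c i * (c j * (v i \<bullet> (B *v v j))))"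
    by (subst (1 2) x) (simp add: matrix_vector_sum_scaleR inner_sum_left inner_sum_right
        sum_distrib_left mult_ac)
  then show "x \<bullet> (B *v x) = (\<Sum>i\<in>UNIV. (c i)\<^sup>2)"
    by (simp add: generalized_eigenbasis_orthonormal[OF e] if_distrib power2_eq_square mult_ac cong: if_cong)
qed

lemma generalized_eigenbasis_eigenvalue_pos:
  assumes e: "generalized_eigenbasis B H v l" and H: "sym_pos_def H"
  shows "0 < l i"
proof -
  have "v i \<noteq> 0" using generalized_eigenbasis_orthonormal[OF e, of i i] by auto
  then have "0 < v i \<bullet> (H *v v i)" by (rule sym_pos_def_posD[OF H])
  then show ?thesis
    by (simp add: generalized_eigenbasis_eigen[OF e] generalized_eigenbasis_orthonormal[OF e])
qed

lemma inner_generalized_eigenbasis: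
  assumes e: "generalized_eigenbasis B H v l" and "transpose H = H" "transpose B = B"
  shows "v i \<bullet> (H *v x) = l i * (v i \<bullet> (B *v x))"
  by (simp add: inner_matrix_symmetric assms generalized_eigenbasis_eigen[OF e])

text \<open>\<open>Max\<close> is an upper bound only for finite sets, so the spectrum must be shown
  finite first. An eigenvector has some nonzero coordinate \<open>j\<close>, and comparing that
  coordinate on both sides of the eigenvalue equation identifies the eigenvalue as
  \<open>l j\<close>.\<close>

lemma eigenvalue_le_lambda_max:
  assumes e: "generalized_eigenbasis B H v l" and H: "transpose H = H" and B: "sym_pos_def B"
  shows "l i \<le> lambda_max (matrix_inv B ** H)"
proof -
  note inv = matrix_inv_vector[OF sym_pos_def_invertible[OF B]]
  have "eigenvalues (matrix_inv B ** H) \<subseteq> range l"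
  proof
    fix m assume "m \<in> eigenvalues (matrix_inv B ** H)"
    then obtain w where w: "w \<noteq> 0" "(matrix_inv B ** H) *v w = m *\<^sub>R w"
      by (auto simp: eigenvalues_def)
    have Hw: "H *v w = m *\<^sub>R (B *v w)"
      by (metis inv(1) matrix_vector_mul_assoc matrix_vector_mult_scaleR w(2))
    obtain j where j: "v j \<bullet> (B *v w) \<noteq> 0"
      using generalized_eigenbasis_expansion[OF e, of w] w(1) by force
    have "l j * (v j \<bullet> (B *v w)) = m * (v j \<bullet> (B *v w))"
      using inner_generalized_eigenbasis[OF e H sym_pos_def_symD[OF B], of j w] Hw
      by (simp only: inner_scaleR_right)
    with j show "m \<in> range l" by (metis mult_right_cancel rangeI)
  qed
  then have "finite (eigenvalues (matrix_inv B ** H))"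
    by (rule finite_subset) simp
  moreover have "l i \<in> eigenvalues (matrix_inv B ** H)"
  proof -
    have "v i \<noteq> 0" using generalized_eigenbasis_orthonormal[OF e, of i i] by auto
    moreover have "(matrix_inv B ** H) *v v i = l i *\<^sub>R v i"
      by (simp add: matrix_vector_mul_assoc[symmetric] generalized_eigenbasis_eigen[OF e]
          matrix_vector_mult_scaleR inv)
    ultimately show ?thesis by (auto simp: eigenvalues_def)
  qed
  ultimately show ?thesis by (simp add: lambda_max_def)
qed

text \<open>The inverse is the explicit matrix \<open>C\<close>, the sum of the rank-one matrices of
  the \<open>v i\<close> with weights \<open>1 / m i\<close>. A general \<open>A\<close> is allowed
  because both \<open>H\<close> and \<open>B - (\<alpha> / 2) *\<^sub>R H\<close> are of this kind,
  for the same basis.\<close>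

lemma trace_matrix_inv_mult:
  fixes B H A S :: "real^'n^'n"
  assumes e: "generalized_eigenbasis B H v l" and B: "sym_pos_def B"
    and A: "\<And>i. A *v v i = m i *\<^sub>R (B *v v i)" and m: "\<And>i. m i \<noteq> 0"
  shows "trace (matrix_inv A ** S) = (\<Sum>i\<in>UNIV. (v i \<bullet> (S *v v i)) / m i)"
proof -
  define C :: "real^'n^'n" where "C = (\<chi> a b. \<Sum>i\<in>UNIV. v i $ a * v i $ b / m i)"
  have C: "C *v x = (\<Sum>i\<in>UNIV. ((v i \<bullet> x) / m i) *\<^sub>R v i)" for x
  proof -
    have "(C *v x) $ a = (\<Sum>i\<in>UNIV. ((v i \<bullet> x) / m i) *\<^sub>R v i) $ a" for a
      unfolding C_def
      by (simp add: matrix_vector_mult_def inner_vec_def sum_distrib_right sum_distrib_left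
          sum_divide_distrib mult_ac, subst sum.swap, simp)
    then show ?thesis by (simp add: vec_eq_iff)
  qed
  have "(A ** C) *v x = x" for x
  proof -
    \<comment> \<open>Writing the argument as \<open>B *v y\<close> turns the inner products
      \<open>v i \<bullet> x\<close> into the coordinates in which \<open>y\<close> is
      expanded.\<close>
    define y where "y = matrix_inv B *v x"
    have y: "B *v y = x" by (simp add: y_def matrix_inv_vector sym_pos_def_invertible[OF B])
    have "(A ** C) *v x = (\<Sum>i\<in>UNIV. (v i \<bullet> (B *v y)) *\<^sub>R (B *v v i))"
      using m by (simp add: matrix_vector_mul_assoc[symmetric] C matrix_vector_sum_scaleR A y)
    also have "\<dots> = B *v y"
      by (subst (2) generalized_eigenbasis_expansion[OF e, of y]) (simp add: matrix_vector_sum_scaleR)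
    finally show ?thesis by (simp add: y)
  qed
  then have "A ** C = mat 1" by (metis matrix_eq matrix_vector_mul_lid)
  then have inv: "matrix_inv A = C" by (rule matrix_inv_eqI)
  have "trace (C ** S) = (\<Sum>a\<in>UNIV. \<Sum>b\<in>UNIV. \<Sum>i\<in>UNIV. v i $ a * v i $ b * S $ b $ a / m i)"
    by (simp add: trace_def matrix_matrix_mult_def C_def sum_distrib_right)
  also have "\<dots> = (\<Sum>b\<in>UNIV. \<Sum>a\<in>UNIV. \<Sum>i\<in>UNIV. v i $ a * v i $ b * S $ b $ a / m i)"
    by (rule sum.swap)
  also have "\<dots> = (\<Sum>b\<in>UNIV. \<Sum>i\<in>UNIV. \<Sum>a\<in>UNIV. v i $ a * v i $ b * S $ b $ a / m i)"
    by (intro sum.cong refl sum.swap)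
  also have "\<dots> = (\<Sum>i\<in>UNIV. \<Sum>b\<in>UNIV. \<Sum>a\<in>UNIV. v i $ a * v i $ b * S $ b $ a / m i)"
    by (rule sum.swap)
  also have "\<dots> = (\<Sum>i\<in>UNIV. (v i \<bullet> (S *v v i)) / m i)"
    by (simp add: inner_vec_def matrix_vector_mult_def sum_distrib_left sum_divide_distrib mult_ac)
  finally show ?thesis by (simp add: inv)
qed

subsection \<open>Square roots of positive semidefinite matrices\<close>

lemma sym_pos_def_mat_1: "sym_pos_def (mat 1 :: real^'n^'n)"
  by (simp add: sym_pos_def_def)

text \<open>In an orthonormal eigenbasis of \<open>A\<close> it suffices to take square roots of the
  eigenvalues.\<close>

lemma sym_pos_semidef_sqrt_exists:
  fixes A :: "real^'n^'n"
  assumes A: "sym_pos_semidef A"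
  obtains S where "sym_pos_semidef S" "S ** S = A"
proof -
  have symA: "transpose A = A" using A by (simp add: sym_pos_semidef_def)
  obtain v l where e: "generalized_eigenbasis (mat 1) A v l"
    using generalized_eigenbasis_exists[OF symA sym_pos_def_mat_1] .
  have l: "0 \<le> l i" for i
  proof -
    have "0 \<le> v i \<bullet> (A *v v i)" using A by (simp add: sym_pos_semidef_def)
    then show ?thesis
      using generalized_eigenbasis_orthonormal[OF e, of i i] generalized_eigenbasis_eigen[OF e, of i]
      by simp
  qed
  define S :: "real^'n^'n" where "S = (\<chi> a b. \<Sum>i\<in>UNIV. sqrt (l i) * v i $ a * v i $ b)"
  have S: "S *v x = (\<Sum>i\<in>UNIV. (sqrt (l i) * (v i \<bullet> x)) *\<^sub>R v i)" for x
  proof -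
    have "(S *v x) $ a = (\<Sum>i\<in>UNIV. (sqrt (l i) * (v i \<bullet> x)) *\<^sub>R v i) $ a" for a
      unfolding S_def
      by (simp add: matrix_vector_mult_def inner_vec_def sum_distrib_right sum_distrib_left
          mult_ac, subst sum.swap, simp)
    then show ?thesis by (simp add: vec_eq_iff)
  qed
  have Sv: "S *v v i = sqrt (l i) *\<^sub>R v i" for i
    using generalized_eigenbasis_orthonormal[OF e]
    by (simp add: S if_distrib[of "\<lambda>x. x *\<^sub>R _"] if_distrib[of "\<lambda>x. _ * x"] cong: if_cong)
  have "(S ** S) *v x = A *v x" for x
    by (subst (1 2) generalized_eigenbasis_expansion[OF e, of x])
      (simp add: matrix_vector_mul_assoc[symmetric] matrix_vector_sum_scaleR Sv matrix_vector_mult_scaleR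
        generalized_eigenbasis_eigen[OF e] l)
  then have "S ** S = A" by (simp add: matrix_eq)
  moreover have "sym_pos_semidef S"
  proof -
    have "transpose S = S" by (simp add: S_def transpose_def vec_eq_iff mult_ac)
    moreover have "0 \<le> x \<bullet> (S *v x)" for x
      by (simp add: S inner_sum_right inner_commute[of x] l sum_nonneg mult.assoc)
    ultimately show ?thesis by (simp add: sym_pos_semidef_def)
  qed
  ultimately show thesis using that by blast
qed

text \<open>The hypothesis factors as (S + m)(S - m) t = 0. For m > 0 the vector u = (S - m) t would
  be an eigenvector of \<open>S\<close> for the negative value -m unless it is zero. For m = 0 the
  squared norm of S t equals the inner product of t with S (S t), which is zero.\<close>

lemma sym_pos_semidef_sqrt_eigenvector:
  fixes S :: "real^'n^'n"
  assumes S: "sym_pos_semidef S" and m: "0 \<le> m" and t: "S *v (S *v t) = (m * m) *\<^sub>R t"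
  shows "S *v t = m *\<^sub>R t"
proof (cases "m = 0")
  case True
  have "(S *v t) \<bullet> (S *v t) = t \<bullet> (S *v (S *v t))"
    using S by (simp add: sym_pos_semidef_def inner_matrix_symmetric)
  then show ?thesis using t True by simp
next
  case False
  define u where "u = S *v t - m *\<^sub>R t"
  have "S *v u = - m *\<^sub>R u"
    by (simp add: u_def t algebra_simps)
  moreover have "0 \<le> u \<bullet> (S *v u)" using S by (simp add: sym_pos_semidef_def)
  ultimately have "m * (u \<bullet> u) \<le> 0" by simp
  with False m have "u \<bullet> u \<le> 0" by (simp add: mult_le_0_iff)
  then have "u = 0" using inner_gt_zero_iff[of u] by linarith
  then show ?thesis by (simp add: u_def)
qed

text \<open>Each vector of an orthonormal eigenbasis of \<open>T\<close> is an eigenvector of the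
  common square, hence of \<open>S\<close> with the same nonnegative eigenvalue. So \<open>S\<close>
  and \<open>T\<close> agree on a basis.\<close>

lemma sym_pos_semidef_sqrt_unique:
  fixes S T :: "real^'n^'n"
  assumes S: "sym_pos_semidef S" and T: "sym_pos_semidef T" and eq: "S ** S = T ** T"
  shows "S = T"
proof -
  have symT: "transpose T = T" using T by (simp add: sym_pos_semidef_def)
  obtain v l where e: "generalized_eigenbasis (mat 1) T v l"
    using generalized_eigenbasis_exists[OF symT sym_pos_def_mat_1] .
  have Tv: "T *v v i = l i *\<^sub>R v i" for i
    using generalized_eigenbasis_eigen[OF e, of i] by simp
  have ST: "S *v v i = T *v v i" for i
  proof -
    have "0 \<le> v i \<bullet> (T *v v i)" using T by (simp add: sym_pos_semidef_def)
    then have "0 \<le> l i"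
      using generalized_eigenbasis_orthonormal[OF e, of i i] Tv by simp
    moreover have "S *v (S *v v i) = (l i * l i) *\<^sub>R v i"
    proof -
      have "S *v (S *v v i) = T *v (T *v v i)"
        by (simp only: matrix_vector_mul_assoc eq)
      then show ?thesis by (simp add: Tv matrix_vector_mult_scaleR)
    qed
    ultimately have "S *v v i = l i *\<^sub>R v i"
      by (rule sym_pos_semidef_sqrt_eigenvector[OF S])
    then show ?thesis by (simp only: Tv)
  qed
  have "S *v x = T *v x" for x
  proof -
    define c where "c i = v i \<bullet> (mat 1 *v x)" for i
    have "x = (\<Sum>i\<in>UNIV. c i *\<^sub>R v i)"
      unfolding c_def by (rule generalized_eigenbasis_expansion[OF e])
    then show ?thesis by (simp only: matrix_vector_sum_scaleR ST)
  qed
  then show ?thesis by (simp add: matrix_eq)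
qed

lemma matrix_sqrt:
  fixes A :: "real^'n^'n"
  assumes "sym_pos_semidef A"
  shows "sym_pos_semidef (matrix_sqrt A)" and "matrix_sqrt A ** matrix_sqrt A = A"
proof -
  obtain S where "sym_pos_semidef S \<and> S ** S = A"
    using sym_pos_semidef_sqrt_exists[OF assms] by blast
  moreover from this have "T = S" if "sym_pos_semidef T \<and> T ** T = A" for T
    using sym_pos_semidef_sqrt_unique[of T S] that by simp
  ultimately have "sym_pos_semidef (matrix_sqrt A) \<and> matrix_sqrt A ** matrix_sqrt A = A"
    unfolding matrix_sqrt_def by (rule theI)
  then show "sym_pos_semidef (matrix_sqrt A)" and "matrix_sqrt A ** matrix_sqrt A = A" by auto
qed

lemma norm_matrix_sqrt_mult:
  fixes A :: "real^'n^'n"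
  assumes A: "sym_pos_semidef A"
  shows "(norm (matrix_sqrt A *v x))\<^sup>2 = x \<bullet> (A *v x)"
proof -
  have "transpose (matrix_sqrt A) = matrix_sqrt A"
    using matrix_sqrt(1)[OF A] by (simp add: sym_pos_semidef_def)
  from inner_matrix_symmetric[OF this, of x "matrix_sqrt A *v x"] show ?thesis
    by (simp add: power2_norm_eq_inner matrix_vector_mul_assoc matrix_sqrt(2)[OF A])
qed

text \<open>The inverse root of \<open>A\<close> times \<open>A\<close> is the root of
  \<open>A\<close>. The first bias bound is brought to this shape by writing
  \<open>B *v (\<theta>0 - \<theta>s)\<close> as \<open>H *v y\<close>.\<close>

lemma norm_inv_matrix_sqrt_mult:
  fixes A :: "real^'n^'n"
  assumes A: "sym_pos_def A"
  shows "(norm (matrix_inv (matrix_sqrt A) *v (A *v x)))\<^sup>2 = x \<bullet> (A *v x)"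
proof -
  note psd = sym_pos_def_imp_semidef[OF A]
  note sq = matrix_sqrt(2)[OF psd]
  have "x = 0" if "matrix_sqrt A *v x = 0" for x
  proof -
    have "A *v x = matrix_sqrt A *v (matrix_sqrt A *v x)"
      by (simp add: matrix_vector_mul_assoc sq)
    with that have "A *v x = 0" by simp
    with sym_pos_def_invertible[OF A] show "x = 0" by (simp add: invertible_iff_ker)
  qed
  then have "invertible (matrix_sqrt A)" by (simp add: invertible_iff_ker)
  then have "matrix_inv (matrix_sqrt A) *v (A *v x) = matrix_sqrt A *v x"
    using matrix_inv_vector(2)[of "matrix_sqrt A" "matrix_sqrt A *v x"]
    by (simp add: matrix_vector_mul_assoc sq)
  then show ?thesis by (simp add: norm_matrix_sqrt_mult[OF psd])
qed

subsection \<open>Geometric sums and uncorrelated noise\<close>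

lemma geometric_sum_mult:
  fixes x :: real
  shows "x * (\<Sum>m<r. (1 - x) ^ m) = 1 - (1 - x) ^ r"
  using one_diff_power_eq[of "1 - x" r] by simp

lemma geometric_sum_le_card:
  fixes x :: real
  assumes "0 < x" "x < 1"
  shows "(\<Sum>m<r. (1 - x) ^ m) \<le> real r"
proof -
  have "(\<Sum>m<r. (1 - x) ^ m) \<le> (\<Sum>m<r. 1)"
    using assms by (intro sum_mono power_le_one) auto
  then show ?thesis by simp
qed

lemma geometric_sum_nonneg:
  fixes x :: real
  assumes "0 < x" "x < 1"
  shows "0 \<le> (\<Sum>m<r. (1 - x) ^ m)"
  using assms by (intro sum_nonneg) auto

lemma geometric_sum_mult_le_1:
  fixes x :: real
  assumes "0 < x" "x < 1"
  shows "x * (\<Sum>m<r. (1 - x) ^ m) \<le> 1"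
  using assms by (simp add: geometric_sum_mult)

text \<open>After Cauchy-Schwarz the squared terms again form a geometric sum, with ratio
  \<open>(1 - x)\<^sup>2 = 1 - x * (2 - x)\<close>. The factor \<open>2 - x\<close> is the origin of
  the matrix \<open>B - (\<alpha> / 2) *\<^sub>R H\<close> in the theorem.\<close>

lemma geometric_sum_squared_le:
  fixes x :: real
  assumes "0 < x" "x < 1"
  shows "(\<Sum>m<r. (1 - x) ^ m)\<^sup>2 \<le> real r / (x * (2 - x))"
proof -
  have pos: "0 < x * (2 - x)" using assms by simp
  have "(\<Sum>m<r. (1 - x) ^ m)\<^sup>2 \<le> (\<Sum>m<r. ((1 - x) ^ m)\<^sup>2) * real r"
    using sum_squared_le_sum_of_squares[of "\<lambda>m. (1 - x) ^ m" "{..<r}"] by simp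
  also have "(\<Sum>m<r. ((1 - x) ^ m)\<^sup>2) = (\<Sum>m<r. (1 - x * (2 - x)) ^ m)"
  proof -
    have "((1 - x) ^ m)\<^sup>2 = ((1 - x)\<^sup>2) ^ m" for m
      by (simp add: power_mult[symmetric] mult.commute)
    moreover have "(1 - x)\<^sup>2 = 1 - x * (2 - x)" by (simp add: power2_eq_square algebra_simps)
    ultimately show ?thesis by simp
  qed
  also have "\<dots> = (1 - (1 - x * (2 - x)) ^ r) / (x * (2 - x))"
    by (metis geometric_sum_mult less_irrefl nonzero_mult_div_cancel_left pos)
  also have "\<dots> \<le> 1 / (x * (2 - x))"
  proof -
    have "1 - x * (2 - x) = (1 - x)\<^sup>2" by (simp add: power2_eq_square algebra_simps)
    then have "0 \<le> (1 - x * (2 - x)) ^ r" by simp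
    with pos show ?thesis by (intro divide_right_mono) auto
  qed
  finally show ?thesis by (simp add: mult_right_mono)
qed

text \<open>The initial value occurs in all \<open>Suc k\<close> summands, whereas
  \<open>z j\<close> enters first at index \<open>Suc j\<close> and so occurs in
  \<open>k - j\<close> of them, each time damped by one more factor \<open>p\<close>.\<close>

lemma linear_recurrence_sum:
  fixes X z :: "nat \<Rightarrow> real"
  assumes rec: "\<And>j. X (Suc j) = p * X j - a * z j"
  shows "(\<Sum>i\<le>k. X i) = X 0 * (\<Sum>m<Suc k. p ^ m) - a * (\<Sum>j<k. (\<Sum>m<k - j. p ^ m) * z j)"
proof -
  have X: "X i = X 0 * p ^ i - a * (\<Sum>j<i. p ^ (i - Suc j) * z j)" for i
  proof (induction i)
    case (Suc i)
    have "(\<Sum>j<i. p ^ (i - j) * z j) = p * (\<Sum>j<i. p ^ (i - Suc j) * z j)"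
      unfolding sum_distrib_left
    proof (rule sum.cong)
      fix j assume "j \<in> {..<i}"
      then have "i - j = Suc (i - Suc j)" by simp
      then show "p ^ (i - j) * z j = p * (p ^ (i - Suc j) * z j)" by simp
    qed simp
    then show ?case by (simp add: rec Suc.IH algebra_simps)
  qed simp
  show ?thesis
  proof (induction k)
    case (Suc k)
    \<comment> \<open>The new summand \<open>X (Suc k)\<close> lengthens each geometric weight by
      one term; for \<open>j = k\<close> the old weight is the empty sum.\<close>
    have "(\<Sum>j<Suc k. (\<Sum>m<Suc k - j. p ^ m) * z j)
        = (\<Sum>j<k. (\<Sum>m<k - j. p ^ m) * z j) + (\<Sum>j<Suc k. p ^ (Suc k - Suc j) * z j)"
      by (simp add: Suc_diff_le algebra_simps sum.distrib)
    then show ?case using Suc.IH X[of "Suc k"] by (simp add: algebra_simps)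
  qed simp
qed

section \<open>Square integrable random variables\<close>

lemma integrable_mult_of_squares:
  fixes f g :: "'a \<Rightarrow> real"
  assumes [measurable]: "f \<in> borel_measurable M" "g \<in> borel_measurable M"
    and f: "integrable M (\<lambda>\<omega>. (f \<omega>)\<^sup>2)" and g: "integrable M (\<lambda>\<omega>. (g \<omega>)\<^sup>2)"
  shows "integrable M (\<lambda>\<omega>. f \<omega> * g \<omega>)"
proof (rule Bochner_Integration.integrable_bound)
  show "integrable M (\<lambda>\<omega>. (f \<omega>)\<^sup>2 + (g \<omega>)\<^sup>2)" using f g by simp
  show "AE \<omega> in M. norm (f \<omega> * g \<omega>) \<le> norm ((f \<omega>)\<^sup>2 + (g \<omega>)\<^sup>2)"
  proof (rule AE_I2)
    fix \<omega>
    have "2 * (\<bar>f \<omega>\<bar> * \<bar>g \<omega>\<bar>) \<le> (f \<omega>)\<^sup>2 + (g \<omega>)\<^sup>2"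
      using sum_squares_bound[of "\<bar>f \<omega>\<bar>" "\<bar>g \<omega>\<bar>"] by simp
    moreover have "0 \<le> \<bar>f \<omega>\<bar> * \<bar>g \<omega>\<bar>" by simp
    ultimately have "\<bar>f \<omega>\<bar> * \<bar>g \<omega>\<bar> \<le> (f \<omega>)\<^sup>2 + (g \<omega>)\<^sup>2" by linarith
    then show "norm (f \<omega> * g \<omega>) \<le> norm ((f \<omega>)\<^sup>2 + (g \<omega>)\<^sup>2)"
      by (simp add: abs_mult)
  qed
qed simp

text \<open>Measurability is demanded separately because integrability of the square does not imply
  it for \<open>f\<close> itself.\<close>

definition square_integrable :: "'a measure \<Rightarrow> ('a \<Rightarrow> real) \<Rightarrow> bool" where
  "square_integrable M f \<longleftrightarrow> f \<in> borel_measurable M \<and> integrable M (\<lambda>\<omega>. (f \<omega>)\<^sup>2)"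

lemma square_integrable_mult:
  "square_integrable M f \<Longrightarrow> square_integrable M g \<Longrightarrow> integrable M (\<lambda>\<omega>. f \<omega> * g \<omega>)"
  by (simp add: square_integrable_def integrable_mult_of_squares)

lemma square_integrable_measurable: "square_integrable M f \<Longrightarrow> f \<in> borel_measurable M"
  by (simp add: square_integrable_def)

lemma square_integrable_cmult:
  "square_integrable M f \<Longrightarrow> square_integrable M (\<lambda>\<omega>. c * f \<omega>)"
  by (auto simp: square_integrable_def power_mult_distrib)

lemma square_integrable_diff:
  assumes f: "square_integrable M f" and g: "square_integrable M g"
  shows "square_integrable M (\<lambda>\<omega>. f \<omega> - g \<omega>)"
proof -
  have "(\<lambda>\<omega>. (f \<omega> - g \<omega>)\<^sup>2) = (\<lambda>\<omega>. (f \<omega>)\<^sup>2 + (g \<omega>)\<^sup>2 - 2 * (f \<omega> * g \<omega>))"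
    by (auto simp: power2_diff)
  then show ?thesis
    using f g square_integrable_mult[OF f g] by (auto simp: square_integrable_def)
qed

text \<open>Agreement on \<open>space M\<close> is enough, which matters because the iteration is
  given only there.\<close>

lemma square_integrable_cong:
  assumes "\<And>\<omega>. \<omega> \<in> space M \<Longrightarrow> f \<omega> = g \<omega>" and f: "square_integrable M f"
  shows "square_integrable M g"
proof -
  have "g \<in> borel_measurable M"
    using f assms(1) by (subst measurable_cong[of M g f]) (auto simp: square_integrable_def)
  moreover have "integrable M (\<lambda>\<omega>. (g \<omega>)\<^sup>2)"
    using f assms(1) by (subst Bochner_Integration.integrable_cong[of M M _ "\<lambda>\<omega>. (f \<omega>)\<^sup>2"])
      (auto simp: square_integrable_def)
  ultimately show ?thesis by (simp add: square_integrable_def)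
qed

lemma square_integrable_inner:
  fixes Y :: "'a \<Rightarrow> real^'n"
  assumes [measurable]: "Y \<in> borel_measurable M" and Y: "integrable M (\<lambda>\<omega>. (norm (Y \<omega>))\<^sup>2)"
  shows "square_integrable M (\<lambda>\<omega>. u \<bullet> Y \<omega>)"
  unfolding square_integrable_def
proof
  show "integrable M (\<lambda>\<omega>. (u \<bullet> Y \<omega>)\<^sup>2)"
  proof (rule Bochner_Integration.integrable_bound)
    show "integrable M (\<lambda>\<omega>. (norm u)\<^sup>2 * (norm (Y \<omega>))\<^sup>2)" using Y by simp
    show "AE \<omega> in M. norm ((u \<bullet> Y \<omega>)\<^sup>2) \<le> norm ((norm u)\<^sup>2 * (norm (Y \<omega>))\<^sup>2)"
      using Cauchy_Schwarz_ineq2[of u]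
      by (auto simp: power_mult_distrib[symmetric] abs_le_square_iff[symmetric])
  qed simp
qed simp

context prob_space
begin

lemma square_integrable_const: "square_integrable M (\<lambda>_. c)"
  by (simp add: square_integrable_def)

lemma square_integrable_imp_integrable:
  "square_integrable M f \<Longrightarrow> integrable M f"
  using square_integrable_mult[of M "\<lambda>_. 1" f] square_integrable_const by simp

text \<open>After expanding the square, the terms linear in \<open>z\<close> have mean zero and only
  the diagonal of the double sum survives.\<close>

lemma second_moment_uncorrelated_sum:
  fixes z :: "nat \<Rightarrow> 'a \<Rightarrow> real" and c s :: real
  assumes sq: "\<And>j. square_integrable M (z j)"
    and mean: "\<And>j. expectation (z j) = 0"
    and cov: "\<And>i j. expectation (\<lambda>\<omega>. z i \<omega> * z j \<omega>) = (if i = j then s else 0)"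
  shows "integrable M (\<lambda>\<omega>. (c - (\<Sum>j<k. w j * z j \<omega>))\<^sup>2)"
    and "expectation (\<lambda>\<omega>. (c - (\<Sum>j<k. w j * z j \<omega>))\<^sup>2) = c\<^sup>2 + s * (\<Sum>j<k. (w j)\<^sup>2)"
proof -
  note int [simp] = square_integrable_mult[OF sq sq] square_integrable_imp_integrable[OF sq]
  have eq: "(c - (\<Sum>j<k. w j * z j \<omega>))\<^sup>2 =
      c\<^sup>2 - (\<Sum>j<k. 2 * c * w j * z j \<omega>) + (\<Sum>i<k. \<Sum>j<k. w i * w j * (z i \<omega> * z j \<omega>))" for \<omega>
    by (simp add: power2_diff power2_eq_square[of "sum _ _"] sum_product sum_distrib_left mult_ac)
  show "integrable M (\<lambda>\<omega>. (c - (\<Sum>j<k. w j * z j \<omega>))\<^sup>2)"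
    unfolding eq by simp
  show "expectation (\<lambda>\<omega>. (c - (\<Sum>j<k. w j * z j \<omega>))\<^sup>2) = c\<^sup>2 + s * (\<Sum>j<k. (w j)\<^sup>2)"
    unfolding eq
    by (simp add: mean cov prob_space if_distrib sum_distrib_left power2_eq_square mult_ac cong: if_cong)
qed

end

subsection \<open>The stochastic iteration\<close>

lemma inner_matrix_vector_left:
  fixes A :: "real^'n^'m"
  shows "u \<bullet> (A *v y) = (transpose A *v u) \<bullet> y"
  by (metis dot_lmul_matrix transpose_matrix_vector)

text \<open>\<open>Y j\<close> stands for the random gradient sampled at
  \<open>\<theta> j\<close>.\<close>

locale stochastic_gradient = prob_space M
  for M :: "'a measure" +
  fixes H B \<Sigma>g :: "real^'n^'n"
    and \<theta>s \<theta>0 :: "real^'n"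
    and \<alpha> :: real
    and Y :: "nat \<Rightarrow> 'a \<Rightarrow> real^'n"
    and \<theta> :: "nat \<Rightarrow> 'a \<Rightarrow> real^'n"
  assumes init: "\<And>\<omega>. \<omega> \<in> space M \<Longrightarrow> \<theta> 0 \<omega> = \<theta>0"
    and iter: "\<And>j \<omega>. \<omega> \<in> space M \<Longrightarrow> \<theta> (Suc j) \<omega> = \<theta> j \<omega> - \<alpha> *\<^sub>R (matrix_inv B *v Y j \<omega>)"
    and Y_measurable: "\<And>j. Y j \<in> borel_measurable M"
    and Y_square_integrable: "\<And>j. integrable M (\<lambda>\<omega>. (norm (Y j \<omega>))\<^sup>2)"
    and Y_cond_mean: "\<And>j. AE \<omega> in M. cond_mean M (history M \<theta> j) (Y j) \<omega> = H *v (\<theta> j \<omega> - \<theta>s)"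
    and Y_cond_cov: "\<And>j. AE \<omega> in M. cond_cov M (history M \<theta> j) (Y j) \<omega> = \<Sigma>g"
begin

lemma \<theta>_measurable: "\<theta> j \<in> borel_measurable M"
proof (induction j)
  case 0
  show ?case by (subst measurable_cong[of M _ "\<lambda>_. \<theta>0"]) (auto simp: init)
next
  case (Suc j)
  note [measurable] = Suc Y_measurable
  have [measurable]: "(\<lambda>x. matrix_inv B *v x) \<in> borel_measurable borel"
    by (intro borel_measurable_continuous_onI matrix_vector_mult_linear_continuous_on)
  have "(\<lambda>\<omega>. \<theta> j \<omega> - \<alpha> *\<^sub>R (matrix_inv B *v Y j \<omega>)) \<in> borel_measurable M"
    by measurable
  then show ?case by (subst measurable_cong[OF iter]) auto
qed

lemma subalgebra_history: "subalgebra M (history M \<theta> j)"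
proof -
  define G where "G = {\<theta> i -` A \<inter> space M | i A. i \<le> j \<and> A \<in> sets borel}"
  have "G \<subseteq> sets M"
    using \<theta>_measurable by (auto simp: G_def intro: measurable_sets)
  then have "sigma_sets (space M) G \<subseteq> sets M" by (rule sets.sigma_sets_subset)
  moreover have "G \<subseteq> Pow (space M)" by (auto simp: G_def)
  ultimately show ?thesis
    unfolding subalgebra_def history_def G_def[symmetric]
    by (simp add: space_measure_of_conv)
qed

lemma sigma_finite_history: "sigma_finite_subalgebra M (history M \<theta> j)"
  by (rule finite_measure_subalgebra_is_sigma_finite)
    (unfold_locales, rule subalgebra_history)

lemma \<theta>_history_measurable:
  assumes "i \<le> j"
  shows "\<theta> i \<in> borel_measurable (history M \<theta> j)"
proof (rule measurableI)
  fix A :: "(real^'n) set" assume "A \<in> sets borel"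
  then have "\<theta> i -` A \<inter> space M \<in> {\<theta> i -` A \<inter> space M | i A. i \<le> j \<and> A \<in> sets borel}"
    using assms by blast
  then show "\<theta> i -` A \<inter> space (history M \<theta> j) \<in> sets (history M \<theta> j)"
    unfolding history_def by (subst space_measure_of_conv, intro in_measure_of) auto
qed simp

lemma square_integrable_\<theta>: "square_integrable M (\<lambda>\<omega>. u \<bullet> (\<theta> j \<omega> - \<theta>s))"
proof (induction j)
  case 0
  show ?case
    by (rule square_integrable_cong[OF _ square_integrable_const[of "u \<bullet> (\<theta>0 - \<theta>s)"]]) (simp add: init)
next
  case (Suc j)
  have "square_integrable M
      (\<lambda>\<omega>. u \<bullet> (\<theta> j \<omega> - \<theta>s) - \<alpha> * ((transpose (matrix_inv B) *v u) \<bullet> Y j \<omega>))"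
    by (intro square_integrable_diff Suc square_integrable_cmult square_integrable_inner
        Y_measurable Y_square_integrable)
  then show ?case
    by (rule square_integrable_cong[rotated])
      (simp add: iter inner_diff_right inner_matrix_vector_left algebra_simps)
qed

text \<open>A martingale difference: the deviation from the conditional mean. Using the formula for
  the mean in place of \<open>cond_mean\<close>, with which it agrees almost everywhere, makes the
  recursion hold at every point of \<open>space M\<close>.\<close>

definition noise :: "nat \<Rightarrow> 'a \<Rightarrow> real^'n" where
  "noise j \<omega> = Y j \<omega> - H *v (\<theta> j \<omega> - \<theta>s)"

lemma square_integrable_noise: "square_integrable M (\<lambda>\<omega>. u \<bullet> noise j \<omega>)"
proof -
  have "(\<lambda>\<omega>. u \<bullet> noise j \<omega>) = (\<lambda>\<omega>. u \<bullet> Y j \<omega> - (transpose H *v u) \<bullet> (\<theta> j \<omega> - \<theta>s))"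
    by (simp add: noise_def inner_diff_right[of u "Y j _"] inner_matrix_vector_left)
  then show ?thesis
    by (simp add: square_integrable_diff square_integrable_inner Y_measurable Y_square_integrable
        square_integrable_\<theta>)
qed

lemma square_integrable_noise_component: "square_integrable M (\<lambda>\<omega>. noise j \<omega> $ a)"
  using square_integrable_noise[of "axis a 1" j] by (simp add: inner_axis')

lemma square_integrable_Y_component: "square_integrable M (\<lambda>\<omega>. Y j \<omega> $ a)"
  using square_integrable_inner[OF Y_measurable Y_square_integrable, of "axis a 1" j]
  by (simp add: inner_axis')

text \<open>A factor measurable with respect to the history can be pulled out of the conditional
  expectation, so \<open>Y j\<close> may be replaced by its conditional mean.\<close>

lemma noise_component_orthogonal_history:
  assumes f: "f \<in> borel_measurable (history M \<theta> j)" and sq: "square_integrable M f"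
  shows "expectation (\<lambda>\<omega>. f \<omega> * noise j \<omega> $ a) = 0"
proof -
  interpret F: sigma_finite_subalgebra M "history M \<theta> j" by (rule sigma_finite_history)
  note Ya = square_integrable_Y_component[of j a]
  have Da: "square_integrable M (\<lambda>\<omega>. (H *v (\<theta> j \<omega> - \<theta>s)) $ a)"
    using square_integrable_\<theta>[of "transpose H *v axis a 1" j]
    by (simp only: inner_matrix_vector_left[symmetric]) (simp add: inner_axis')
  note int = square_integrable_mult[OF sq Ya] square_integrable_mult[OF sq Da]
  have "expectation (\<lambda>\<omega>. f \<omega> * Y j \<omega> $ a)
      = expectation (\<lambda>\<omega>. f \<omega> * real_cond_exp M (history M \<theta> j) (\<lambda>\<omega>. Y j \<omega> $ a) \<omega>)"
    by (rule F.real_cond_exp_intg(2)[symmetric, OF int(1) f square_integrable_measurable[OF Ya]])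
  also have "\<dots> = expectation (\<lambda>\<omega>. f \<omega> * (H *v (\<theta> j \<omega> - \<theta>s)) $ a)"
  proof (rule integral_cong_AE)
    show "AE \<omega> in M. f \<omega> * real_cond_exp M (history M \<theta> j) (\<lambda>\<omega>. Y j \<omega> $ a) \<omega>
        = f \<omega> * (H *v (\<theta> j \<omega> - \<theta>s)) $ a"
      using Y_cond_mean[of j] by eventually_elim (auto simp: cond_mean_def vec_eq_iff)
  qed (use sq Da in \<open>auto intro!: borel_measurable_times dest: square_integrable_measurable\<close>)
  finally show ?thesis
    using int by (simp add: noise_def right_diff_distrib)
qed

lemma noise_orthogonal_history:
  assumes "f \<in> borel_measurable (history M \<theta> j)" and "square_integrable M f"
  shows "expectation (\<lambda>\<omega>. f \<omega> * (u \<bullet> noise j \<omega>)) = 0"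
proof -
  have "expectation (\<lambda>\<omega>. f \<omega> * (u \<bullet> noise j \<omega>))
      = expectation (\<lambda>\<omega>. \<Sum>a\<in>UNIV. u $ a * (f \<omega> * noise j \<omega> $ a))"
    by (simp add: inner_vec_def sum_distrib_left mult_ac)
  also have "\<dots> = (\<Sum>a\<in>UNIV. u $ a * expectation (\<lambda>\<omega>. f \<omega> * noise j \<omega> $ a))"
    by (simp add: square_integrable_mult[OF assms(2) square_integrable_noise_component])
  finally show ?thesis using noise_component_orthogonal_history[OF assms] by simp
qed

lemma noise_mean: "expectation (\<lambda>\<omega>. u \<bullet> noise j \<omega>) = 0"
  using noise_orthogonal_history[of "\<lambda>_. 1" j u] square_integrable_const by simp

text \<open>The residual inside \<open>cond_cov\<close> equals the noise almost everywhere, and the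
  expectation of its conditional covariance, a constant, is the covariance itself.\<close>

lemma noise_component_covariance: "expectation (\<lambda>\<omega>. noise j \<omega> $ a * noise j \<omega> $ b) = \<Sigma>g $ a $ b"
proof -
  let ?F = "history M \<theta> j"
  interpret F: sigma_finite_subalgebra M ?F by (rule sigma_finite_history)
  let ?R = "\<lambda>\<omega>. Y j \<omega> - cond_mean M ?F (Y j) \<omega>"
  have R_meas: "(\<lambda>\<omega>. ?R \<omega> $ a) \<in> borel_measurable M" for a
    by (simp add: cond_mean_def square_integrable_measurable[OF square_integrable_Y_component]
        borel_measurable_diff)
  have R: "AE \<omega> in M. ?R \<omega> $ a * ?R \<omega> $ b = noise j \<omega> $ a * noise j \<omega> $ b"
    using Y_cond_mean[of j] by eventually_elim (simp add: noise_def)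
  have int: "integrable M (\<lambda>\<omega>. noise j \<omega> $ a * noise j \<omega> $ b)"
    by (intro square_integrable_mult square_integrable_noise_component)
  have RR: "(\<lambda>\<omega>. ?R \<omega> $ a * ?R \<omega> $ b) \<in> borel_measurable M"
    by (intro borel_measurable_times R_meas)
  have intR: "integrable M (\<lambda>\<omega>. ?R \<omega> $ a * ?R \<omega> $ b)"
    by (rule integrable_cong_AE_imp[OF int RR]) (use R in eventually_elim, simp only:)
  have "expectation (\<lambda>\<omega>. noise j \<omega> $ a * noise j \<omega> $ b) = expectation (\<lambda>\<omega>. ?R \<omega> $ a * ?R \<omega> $ b)"
    by (rule integral_cong_AE[OF borel_measurable_integrable[OF int] RR])
      (use R in eventually_elim, simp only:)
  also have "\<dots> = expectation (real_cond_exp M ?F (\<lambda>\<omega>. ?R \<omega> $ a * ?R \<omega> $ b))"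
    by (rule F.real_cond_exp_int(2)[symmetric, OF intR])
  also have "\<dots> = expectation (\<lambda>_. \<Sigma>g $ a $ b)"
  proof (rule integral_cong_AE)
    show "AE \<omega> in M. real_cond_exp M ?F (\<lambda>\<omega>. ?R \<omega> $ a * ?R \<omega> $ b) \<omega> = \<Sigma>g $ a $ b"
      using Y_cond_cov[of j] by eventually_elim (auto simp: cond_cov_def vec_eq_iff)
  qed auto
  finally show ?thesis by (simp add: prob_space)
qed

lemma noise_second_moment: "expectation (\<lambda>\<omega>. (u \<bullet> noise j \<omega>) * (u \<bullet> noise j \<omega>)) = u \<bullet> (\<Sigma>g *v u)"
proof -
  have "expectation (\<lambda>\<omega>. (u \<bullet> noise j \<omega>) * (u \<bullet> noise j \<omega>))
      = expectation (\<lambda>\<omega>. \<Sum>a\<in>UNIV. \<Sum>b\<in>UNIV. (u $ a * u $ b) * (noise j \<omega> $ a * noise j \<omega> $ b))"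
    by (simp add: inner_vec_def sum_product mult_ac)
  also have "\<dots> = (\<Sum>a\<in>UNIV. \<Sum>b\<in>UNIV. (u $ a * u $ b) * \<Sigma>g $ a $ b)"
    by (simp add: square_integrable_mult square_integrable_noise_component noise_component_covariance)
  also have "\<dots> = u \<bullet> (\<Sigma>g *v u)"
    by (simp add: inner_vec_def matrix_vector_mult_def sum_distrib_left mult_ac)
  finally show ?thesis .
qed

end

section \<open>The iteration in generalized eigencoordinates\<close>

locale preconditioned_stochastic_gradient = stochastic_gradient +
  fixes v :: "'b \<Rightarrow> real^'b" and l :: "'b \<Rightarrow> real"
  assumes H: "sym_pos_def H" and B: "sym_pos_def B"
    and eigenbasis: "generalized_eigenbasis B H v l"
    and \<alpha>_pos: "0 < \<alpha>" and step: "\<And>i. \<alpha> * l i < 1"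
begin

definition coord :: "'b \<Rightarrow> nat \<Rightarrow> 'a \<Rightarrow> real" where
  "coord i j \<omega> = v i \<bullet> (B *v (\<theta> j \<omega> - \<theta>s))"

lemma l_pos: "0 < l i"
  by (rule generalized_eigenbasis_eigenvalue_pos[OF eigenbasis H])

text \<open>The factor \<open>B\<close> in the coordinate cancels the preconditioner
  \<open>matrix_inv B\<close>, and \<open>H\<close> acts on the coordinate as multiplication by
  \<open>l i\<close>.\<close>

lemma coord_Suc:
  assumes "\<omega> \<in> space M"
  shows "coord i (Suc j) \<omega> = (1 - \<alpha> * l i) * coord i j \<omega> - \<alpha> * (v i \<bullet> noise j \<omega>)"
proof -
  have "B *v (\<theta> (Suc j) \<omega> - \<theta>s) = B *v (\<theta> j \<omega> - \<theta>s) - \<alpha> *\<^sub>R Y j \<omega>"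
    by (simp add: iter[OF assms] matrix_vector_mult_diff_distrib matrix_vector_mult_scaleR
        matrix_inv_vector sym_pos_def_invertible[OF B])
  then have "coord i (Suc j) \<omega> = coord i j \<omega> - \<alpha> * (v i \<bullet> Y j \<omega>)"
    by (simp add: coord_def inner_diff_right)
  moreover have "v i \<bullet> (H *v (\<theta> j \<omega> - \<theta>s)) = l i * coord i j \<omega>"
    unfolding coord_def
    by (rule inner_generalized_eigenbasis[OF eigenbasis sym_pos_def_symD[OF H] sym_pos_def_symD[OF B]])
  ultimately show ?thesis by (simp add: noise_def inner_diff_right[of "v i"] algebra_simps)
qed

text \<open>An earlier noise term is a function of the history because it can be recovered from two
  consecutive iterates.\<close>

lemma noise_uncorrelated:
  assumes "i < j"
  shows "expectation (\<lambda>\<omega>. (v a \<bullet> noise i \<omega>) * (v a \<bullet> noise j \<omega>)) = 0"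
proof -
  have "(\<lambda>x. v a \<bullet> (B *v (x - \<theta>s))) \<in> borel_measurable borel"
    unfolding inner_matrix_vector_left
    by (intro borel_measurable_inner borel_measurable_diff borel_measurable_const measurable_ident_sets refl)
  then have coord_meas: "coord a m \<in> borel_measurable (history M \<theta> j)" if "m \<le> j" for m
    unfolding coord_def by (rule measurable_compose[OF \<theta>_history_measurable[OF that]])
  \<comment> \<open>This is \<open>coord_Suc\<close> solved for the noise. From \<open>i < j\<close>
    follows \<open>Suc i \<le> j\<close>, so both coordinates belong to the history up to
    \<open>j\<close>.\<close>
  have "(\<lambda>\<omega>. ((1 - \<alpha> * l a) * coord a i \<omega> - coord a (Suc i) \<omega>) / \<alpha>) \<in> borel_measurable (history M \<theta> j)"
    using assms by (intro borel_measurable_divide borel_measurable_diff borel_measurable_times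
        borel_measurable_const coord_meas) auto
  moreover have "(\<lambda>\<omega>. v a \<bullet> noise i \<omega>) \<in> borel_measurable (history M \<theta> j) \<longleftrightarrow>
      (\<lambda>\<omega>. ((1 - \<alpha> * l a) * coord a i \<omega> - coord a (Suc i) \<omega>) / \<alpha>) \<in> borel_measurable (history M \<theta> j)"
    using subalgebra_history \<alpha>_pos
    by (intro measurable_cong) (auto simp: subalgebra_def coord_Suc)
  ultimately have "(\<lambda>\<omega>. v a \<bullet> noise i \<omega>) \<in> borel_measurable (history M \<theta> j)"
    by (simp only:)
  then show ?thesis by (rule noise_orthogonal_history[OF _ square_integrable_noise])
qed

lemma noise_covariance:
  "expectation (\<lambda>\<omega>. (v a \<bullet> noise i \<omega>) * (v a \<bullet> noise j \<omega>)) =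
    (if i = j then v a \<bullet> (\<Sigma>g *v v a) else 0)"
proof (cases i j rule: linorder_cases)
  case greater
  then show ?thesis using noise_uncorrelated[of j i a] by (simp add: mult.commute)
next
  case equal
  then show ?thesis using noise_second_moment[of "v a" j] by simp
next
  case less
  then show ?thesis using noise_uncorrelated[of i j a] by simp
qed

text \<open>The two summands of direction \<open>v i\<close> in the expected objective at the average of the first
  \<open>Suc k\<close> iterates.\<close>

definition variance_part :: "nat \<Rightarrow> 'b \<Rightarrow> real" where
  "variance_part k i = l i / (2 * (real (Suc k))\<^sup>2) *
    (\<alpha>\<^sup>2 * (v i \<bullet> (\<Sigma>g *v v i)) * (\<Sum>j<k. (\<Sum>m<k - j. (1 - \<alpha> * l i) ^ m)\<^sup>2))"

definition bias_part :: "nat \<Rightarrow> 'b \<Rightarrow> real" where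
  "bias_part k i = l i / (2 * (real (Suc k))\<^sup>2) *
    ((v i \<bullet> (B *v (\<theta>0 - \<theta>s)))\<^sup>2 * (\<Sum>m<Suc k. (1 - \<alpha> * l i) ^ m)\<^sup>2)"

lemma quad_obj_iterate_avg:
  "quad_obj H \<theta>s (iterate_avg \<theta> k \<omega>) = (\<Sum>i\<in>UNIV. l i / (2 * (real (Suc k))\<^sup>2) * (\<Sum>j\<le>k. coord i j \<omega>)\<^sup>2)"
proof -
  have "iterate_avg \<theta> k \<omega> - \<theta>s = (1 / real (Suc k)) *\<^sub>R (\<Sum>j\<le>k. \<theta> j \<omega> - \<theta>s)"
  proof -
    have "(\<Sum>j\<le>k. \<theta> j \<omega> - \<theta>s) = (\<Sum>j\<le>k. \<theta> j \<omega>) - real (Suc k) *\<^sub>R \<theta>s"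
      by (simp only: sum_subtractf sum_constant_scaleR card_atMost)
    then show ?thesis
      by (simp add: iterate_avg_def scaleR_diff_right del: of_nat_Suc)
  qed
  then have "v i \<bullet> (B *v (iterate_avg \<theta> k \<omega> - \<theta>s)) = (\<Sum>j\<le>k. coord i j \<omega>) / real (Suc k)" for i
    by (simp add: matrix_vector_mult_scaleR linear_sum[OF matrix_vector_mul_linear] inner_sum_right
        coord_def del: of_nat_Suc)
  then show ?thesis
    unfolding quad_obj_def generalized_eigenbasis_quadratic_form(1)[OF eigenbasis]
    by (simp add: sum_distrib_left power_divide del: of_nat_Suc)
qed

text \<open>The objective is diagonal in the coordinates, so only second moments of their sums over
  time are needed. Each such sum is a constant minus a weighted sum of uncorrelated noise.\<close>

lemma expectation_quad_obj_iterate_avg: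
  "expectation (\<lambda>\<omega>. quad_obj H \<theta>s (iterate_avg \<theta> k \<omega>)) =
    (\<Sum>i\<in>UNIV. variance_part k i) + (\<Sum>i\<in>UNIV. bias_part k i)"
proof -
  \<comment> \<open>By \<open>linear_recurrence_sum\<close>, \<open>c i\<close> is the deterministic
    part of the coordinate sum and \<open>w i j\<close> is the weight of the noise at time
    \<open>j\<close>.\<close>
  define c where "c i = (v i \<bullet> (B *v (\<theta>0 - \<theta>s))) * (\<Sum>m<Suc k. (1 - \<alpha> * l i) ^ m)" for i
  define w where "w i j = \<alpha> * (\<Sum>m<k - j. (1 - \<alpha> * l i) ^ m)" for i j
  define Q where "Q i = (\<lambda>\<omega>. (c i - (\<Sum>j<k. w i j * (v i \<bullet> noise j \<omega>)))\<^sup>2)" for i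
  have S: "(\<Sum>j\<le>k. coord i j \<omega>)\<^sup>2 = Q i \<omega>" if "\<omega> \<in> space M" for i \<omega>
  proof -
    have "coord i 0 \<omega> = v i \<bullet> (B *v (\<theta>0 - \<theta>s))" by (simp add: coord_def init[OF that])
    moreover have "(\<Sum>j<k. w i j * (v i \<bullet> noise j \<omega>))
        = \<alpha> * (\<Sum>j<k. (\<Sum>m<k - j. (1 - \<alpha> * l i) ^ m) * (v i \<bullet> noise j \<omega>))"
      unfolding w_def mult.assoc by (rule sum_distrib_left[symmetric])
    ultimately show ?thesis
      using linear_recurrence_sum[of "\<lambda>j. coord i j \<omega>", OF coord_Suc[OF that], of k]
      by (simp only: Q_def c_def)
  qed
  note moment = second_moment_uncorrelated_sum[OF square_integrable_noise noise_mean noise_covariance]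
  have "expectation (\<lambda>\<omega>. quad_obj H \<theta>s (iterate_avg \<theta> k \<omega>))
      = expectation (\<lambda>\<omega>. \<Sum>i\<in>UNIV. l i / (2 * (real (Suc k))\<^sup>2) * Q i \<omega>)"
    by (rule Bochner_Integration.integral_cong) (simp_all only: quad_obj_iterate_avg S)
  also have "\<dots> = (\<Sum>i\<in>UNIV. l i / (2 * (real (Suc k))\<^sup>2) * expectation (Q i))"
  proof -
    have "integrable M (Q i)" for i unfolding Q_def by (rule moment(1))
    then show ?thesis by simp
  qed
  also have "\<dots> = (\<Sum>i\<in>UNIV. variance_part k i + bias_part k i)"
  proof (rule sum.cong)
    fix i
    have "expectation (Q i) = (c i)\<^sup>2 + (v i \<bullet> (\<Sigma>g *v v i)) * (\<Sum>j<k. (w i j)\<^sup>2)"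
      unfolding Q_def by (rule moment(2))
    then show "l i / (2 * (real (Suc k))\<^sup>2) * expectation (Q i) = variance_part k i + bias_part k i"
      unfolding variance_part_def bias_part_def c_def w_def power_mult_distrib sum_distrib_left[symmetric]
      by (simp only: distrib_left mult_ac add.commute)
  qed simp
  finally show ?thesis by (simp add: sum.distrib)
qed

section \<open>Bounds in a single direction\<close>

lemma noise_variance_nonneg: "0 \<le> v i \<bullet> (\<Sigma>g *v v i)"
proof -
  \<comment> \<open>Nonnegativity of the form of \<open>\<Sigma>g\<close> comes from its being the
    second moment of the noise at time 0.\<close>
  have "0 \<le> expectation (\<lambda>\<omega>. (v i \<bullet> noise 0 \<omega>) * (v i \<bullet> noise 0 \<omega>))"
    by (rule Bochner_Integration.integral_nonneg) simp
  then show ?thesis by (simp only: noise_second_moment)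
qed

lemma step_pos: "0 < \<alpha> * l i"
  using \<alpha>_pos l_pos by simp

text \<open>Multiplied by \<open>x\<close>, each inner geometric sum lies in [0, 1], so the sum of
  the squares is at most the number of noise terms.\<close>

lemma variance_part_le_averaged:
  "variance_part k i \<le> 1 / (2 * real (Suc k)) * ((v i \<bullet> (\<Sigma>g *v v i)) / l i)"
proof -
  define x K s where "x = \<alpha> * l i" and "K = real (Suc k)" and "s = v i \<bullet> (\<Sigma>g *v v i)"
  define V where "V = (\<Sum>j<k. (\<Sum>m<k - j. (1 - x) ^ m)\<^sup>2)"
  have x: "0 < x" "x < 1" using step_pos step by (auto simp: x_def)
  have "x\<^sup>2 * V = (\<Sum>j<k. (x * (\<Sum>m<k - j. (1 - x) ^ m))\<^sup>2)"
    unfolding V_def power_mult_distrib by (rule sum_distrib_left)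
  also have "\<dots> \<le> (\<Sum>j<k. 1)"
  proof (rule sum_mono)
    fix j
    have "0 \<le> x * (\<Sum>m<k - j. (1 - x) ^ m)"
      using geometric_sum_nonneg[OF x] x(1) by simp
    then show "(x * (\<Sum>m<k - j. (1 - x) ^ m))\<^sup>2 \<le> 1"
      by (rule power_le_one) (rule geometric_sum_mult_le_1[OF x])
  qed
  also have "\<dots> \<le> K" by (simp add: K_def)
  finally have "x\<^sup>2 * V \<le> K" .
  moreover have "variance_part k i = s / (2 * K\<^sup>2 * l i) * (x\<^sup>2 * V)"
    unfolding variance_part_def V_def[symmetric] x_def[symmetric] K_def[symmetric] s_def[symmetric]
    using l_pos[of i] by (simp add: x_def power2_eq_square)
  moreover have "0 \<le> s / (2 * K\<^sup>2 * l i)"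
    using noise_variance_nonneg l_pos[of i] by (simp add: s_def)
  ultimately have "variance_part k i \<le> s / (2 * K\<^sup>2 * l i) * K"
    by (simp only: mult_left_mono)
  also have "\<dots> = 1 / (2 * K) * (s / l i)"
    by (simp add: power2_eq_square K_def del: of_nat_Suc)
  finally show ?thesis by (simp only: K_def s_def)
qed

text \<open>Each of the \<open>k\<close> squares is at most \<open>K / (x * (2 - x))\<close>; the
  resulting \<open>K\<^sup>2\<close> cancels the averaging factor, which leaves a bound free of
  \<open>k\<close>.\<close>

lemma variance_part_le_stationary:
  "variance_part k i \<le> \<alpha> / 4 * ((v i \<bullet> (\<Sigma>g *v v i)) / (1 - \<alpha> / 2 * l i))"
proof -
  define x K s where "x = \<alpha> * l i" and "K = real (Suc k)" and "s = v i \<bullet> (\<Sigma>g *v v i)"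
  define V where "V = (\<Sum>j<k. (\<Sum>m<k - j. (1 - x) ^ m)\<^sup>2)"
  have x: "0 < x" "x < 1" using step_pos step by (auto simp: x_def)
  have "V \<le> (\<Sum>j<k. K / (x * (2 - x)))"
    unfolding V_def
  proof (rule sum_mono)
    fix j
    have "(\<Sum>m<k - j. (1 - x) ^ m)\<^sup>2 \<le> real (k - j) / (x * (2 - x))"
      by (rule geometric_sum_squared_le[OF x])
    also have "\<dots> \<le> K / (x * (2 - x))"
      using x by (intro divide_right_mono) (auto simp: K_def)
    finally show "(\<Sum>m<k - j. (1 - x) ^ m)\<^sup>2 \<le> K / (x * (2 - x))" .
  qed
  also have "\<dots> = real k * (K / (x * (2 - x)))"
    by (simp only: sum_constant card_lessThan)
  also have "\<dots> \<le> K * (K / (x * (2 - x)))"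
    using x by (intro mult_right_mono) (auto simp: K_def)
  finally have V: "V \<le> K\<^sup>2 / (x * (2 - x))" by (simp add: power2_eq_square)
  have "variance_part k i = l i / (2 * K\<^sup>2) * (\<alpha>\<^sup>2 * s) * V"
    unfolding variance_part_def V_def x_def K_def s_def by (simp only: mult.assoc)
  also have "\<dots> \<le> l i / (2 * K\<^sup>2) * (\<alpha>\<^sup>2 * s) * (K\<^sup>2 / (x * (2 - x)))"
    using V noise_variance_nonneg[of i] l_pos[of i] by (intro mult_left_mono) (auto simp: s_def)
  also have "\<dots> = (l i * \<alpha>\<^sup>2 * s) / (2 * (x * (2 - x)))"
    by (simp add: K_def del: of_nat_Suc)
  also have "\<dots> = (\<alpha> * s) / (2 * (2 - x))"
    using \<alpha>_pos l_pos[of i] by (simp add: x_def power2_eq_square)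
  \<comment> \<open>Extracting 2 from \<open>2 - x\<close> produces the factor by which
    \<open>B - (\<alpha> / 2) *\<^sub>R H\<close> acts on \<open>v i\<close> relative to
    \<open>B\<close>.\<close>
  also have "\<dots> = \<alpha> / 4 * (s / (1 - x / 2))"
    using x by (simp add: field_simps)
  finally show ?thesis by (simp add: s_def x_def)
qed

text \<open>The geometric sum \<open>G\<close> is at most \<open>1 / x\<close> and at most
  \<open>K\<close>. Using the first bound twice, each once, or the second twice gives the three
  estimates.\<close>

lemma bias_part_le:
  defines "c \<equiv> \<lambda>i. v i \<bullet> (B *v (\<theta>0 - \<theta>s))"
  shows "bias_part k i \<le> 1 / (2 * (real (Suc k))\<^sup>2 * \<alpha>\<^sup>2) * ((c i)\<^sup>2 / l i)"
    and "bias_part k i \<le> 1 / (2 * real (Suc k) * \<alpha>) * (c i)\<^sup>2"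
    and "bias_part k i \<le> 1 / 2 * (l i * (c i)\<^sup>2)"
proof -
  define x K where "x = \<alpha> * l i" and "K = real (Suc k)"
  define G where "G = (\<Sum>m<Suc k. (1 - x) ^ m)"
  have x: "0 < x" "x < 1" using step_pos step by (auto simp: x_def)
  have K: "0 < K" by (simp add: K_def)
  have l: "0 < l i" by (rule l_pos)
  have G: "0 \<le> G" "G \<le> K" "x * G \<le> 1"
    unfolding G_def K_def
    by (rule geometric_sum_nonneg[OF x] geometric_sum_le_card[OF x] geometric_sum_mult_le_1[OF x])+
  have b: "bias_part k i = l i / (2 * K\<^sup>2) * (c i)\<^sup>2 * G\<^sup>2"
    unfolding bias_part_def G_def x_def K_def c_def by (simp only: mult.assoc)
  have nn: "0 \<le> l i / (2 * K\<^sup>2) * (c i)\<^sup>2" using l by simp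
  have "G \<le> 1 / x" using G x by (simp add: field_simps)
  then have "G\<^sup>2 \<le> (1 / x)\<^sup>2" and "G * G \<le> K * (1 / x)" and "G\<^sup>2 \<le> K\<^sup>2"
    using G K by (auto intro: power_mono intro!: mult_mono simp del: times_divide_eq_right mult_1_right)
  note le = this[THEN mult_left_mono[OF _ nn]]
  show "bias_part k i \<le> 1 / (2 * (real (Suc k))\<^sup>2 * \<alpha>\<^sup>2) * ((c i)\<^sup>2 / l i)"
    unfolding K_def[symmetric] using le(1) \<alpha>_pos l K by (simp add: b x_def power2_eq_square field_simps)
  show "bias_part k i \<le> 1 / (2 * real (Suc k) * \<alpha>) * (c i)\<^sup>2"
    unfolding K_def[symmetric] using le(2) \<alpha>_pos l K by (simp add: b x_def power2_eq_square field_simps)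
  show "bias_part k i \<le> 1 / 2 * (l i * (c i)\<^sup>2)"
    unfolding K_def[symmetric] using le(3) l K by (simp add: b power2_eq_square field_simps)
qed

end

section \<open>Summation over the directions\<close>

theorem theorem6:
  fixes M :: "'a measure"
    and H B \<Sigma>g :: "real^'n^'n"
    and \<theta>s \<theta>0 :: "real^'n"
    and \<alpha> :: real
    and g :: "nat \<Rightarrow> real^'n \<Rightarrow> 'a \<Rightarrow> real^'n"
    and \<theta> :: "nat \<Rightarrow> 'a \<Rightarrow> real^'n"
    and k :: nat
  assumes M: "prob_space M"
    and H: "sym_pos_def H"
    and B: "sym_pos_def B"
    and \<alpha>: "\<alpha> > 0"
    and step: "\<alpha> * lambda_max (matrix_inv B ** H) < 1"
    and init: "\<And>\<omega>. \<omega> \<in> space M \<Longrightarrow> \<theta> 0 \<omega> = \<theta>0"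
    and iter: "\<And>j \<omega>. \<omega> \<in> space M \<Longrightarrow>
      \<theta> (Suc j) \<omega> = \<theta> j \<omega> - \<alpha> *\<^sub>R (matrix_inv B *v g j (\<theta> j \<omega>) \<omega>)"
    and g_measurable: "\<And>j. (\<lambda>\<omega>. g j (\<theta> j \<omega>) \<omega>) \<in> borel_measurable M"
    and g_square_integrable: "\<And>j. integrable M (\<lambda>\<omega>. (norm (g j (\<theta> j \<omega>) \<omega>))\<^sup>2)"
    and g_cond_distr: "\<And>j A. A \<in> sets borel \<Longrightarrow> AE \<omega> in M.
      cond_prob_alg M (history M \<theta> j) {\<omega> \<in> space M. g j (\<theta> j \<omega>) \<omega> \<in> A} \<omega> =
      cond_prob_alg M (vimage_algebra (space M) (\<theta> j) borel)
        {\<omega> \<in> space M. g j (\<theta> j \<omega>) \<omega> \<in> A} \<omega>"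
    and g_cond_mean: "\<And>j. AE \<omega> in M.
      cond_mean M (history M \<theta> j) (\<lambda>\<omega>. g j (\<theta> j \<omega>) \<omega>) \<omega> = H *v (\<theta> j \<omega> - \<theta>s)"
    and g_cond_cov: "\<And>j. AE \<omega> in M.
      cond_cov M (history M \<theta> j) (\<lambda>\<omega>. g j (\<theta> j \<omega>) \<omega>) \<omega> = \<Sigma>g"
  shows "prob_space.expectation M (\<lambda>\<omega>. quad_obj H \<theta>s (iterate_avg \<theta> k \<omega>)) - quad_obj H \<theta>s \<theta>s
    \<le> min (1 / (2 * real (k + 1)) * trace (matrix_inv H ** \<Sigma>g))
          (\<alpha> / 4 * trace (matrix_inv (B - (\<alpha> / 2) *\<^sub>R H) ** \<Sigma>g))
      + min (1 / (2 * (real (k + 1))\<^sup>2 * \<alpha>\<^sup>2) *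
               (norm (matrix_inv (matrix_sqrt H) *v (B *v (\<theta>0 - \<theta>s))))\<^sup>2)
          (min (1 / (2 * real (k + 1) * \<alpha>) * (norm (matrix_sqrt B *v (\<theta>0 - \<theta>s)))\<^sup>2)
               (quad_obj H \<theta>s \<theta>0))"
proof -
  obtain v l where e: "generalized_eigenbasis B H v l"
    using generalized_eigenbasis_exists[OF sym_pos_def_symD[OF H] B] .
  have small: "\<alpha> * l i < 1" for i
    using mult_left_mono[OF eigenvalue_le_lambda_max[OF e sym_pos_def_symD[OF H] B, of i], of \<alpha>]
      \<alpha> step by linarith
  interpret prob_space M by (rule M)
  interpret preconditioned_stochastic_gradient M H B \<Sigma>g \<theta>s \<theta>0 \<alpha> "\<lambda>j \<omega>. g j (\<theta> j \<omega>) \<omega>" \<theta> v l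
    by unfold_locales (fact init iter g_measurable g_square_integrable g_cond_mean g_cond_cov H B e \<alpha> small)+
  define d where "d = \<theta>0 - \<theta>s"
  define c where "c i = v i \<bullet> (B *v d)" for i
  have tr1: "trace (matrix_inv H ** \<Sigma>g) = (\<Sum>i\<in>UNIV. (v i \<bullet> (\<Sigma>g *v v i)) / l i)"
  proof (rule trace_matrix_inv_mult[OF e B])
    show "H *v v i = l i *\<^sub>R (B *v v i)" for i by (rule generalized_eigenbasis_eigen[OF e])
    show "l i \<noteq> 0" for i using l_pos[of i] by simp
  qed
  have tr2: "trace (matrix_inv (B - (\<alpha> / 2) *\<^sub>R H) ** \<Sigma>g)
      = (\<Sum>i\<in>UNIV. (v i \<bullet> (\<Sigma>g *v v i)) / (1 - \<alpha> / 2 * l i))"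
  proof (rule trace_matrix_inv_mult[OF e B])
    show "(B - (\<alpha> / 2) *\<^sub>R H) *v v i = (1 - \<alpha> / 2 * l i) *\<^sub>R (B *v v i)" for i
      by (simp add: matrix_vector_mult_diff_rdistrib scaleR_matrix_vector_assoc[symmetric]
          generalized_eigenbasis_eigen[OF e] scaleR_diff_left)
    show "1 - \<alpha> / 2 * l i \<noteq> 0" for i using small[of i] by simp
  qed
  have nB: "(norm (matrix_sqrt B *v d))\<^sup>2 = (\<Sum>i\<in>UNIV. (c i)\<^sup>2)"
    unfolding c_def norm_matrix_sqrt_mult[OF sym_pos_def_imp_semidef[OF B]]
    by (rule generalized_eigenbasis_quadratic_form(2)[OF e])
  have nH: "(norm (matrix_inv (matrix_sqrt H) *v (B *v d)))\<^sup>2 = (\<Sum>i\<in>UNIV. (c i)\<^sup>2 / l i)"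
  proof -
    \<comment> \<open>Solving \<open>H *v y = B *v d\<close> makes the norm a quadratic form of
      \<open>H\<close> at \<open>y\<close>, whose coordinates are \<open>c i / l i\<close>.\<close>
    define y where "y = matrix_inv H *v (B *v d)"
    have y: "H *v y = B *v d"
      by (simp add: y_def matrix_inv_vector sym_pos_def_invertible[OF H])
    have "l i * (v i \<bullet> (B *v y)) = c i" for i
      using inner_generalized_eigenbasis[OF e sym_pos_def_symD[OF H] sym_pos_def_symD[OF B], of i y]
      by (simp add: y c_def)
    then have "l i * (v i \<bullet> (B *v y))\<^sup>2 = (c i)\<^sup>2 / l i" for i
      using l_pos[of i] by (metis less_irrefl nonzero_mult_div_cancel_left power2_eq_square mult.assoc mult.left_commute)
    then show ?thesis
      using norm_inv_matrix_sqrt_mult[OF H, of y] generalized_eigenbasis_quadratic_form(1)[OF e, of y]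
      by (simp add: y)
  qed
  have h0: "quad_obj H \<theta>s \<theta>0 = (\<Sum>i\<in>UNIV. 1 / 2 * (l i * (c i)\<^sup>2))"
    unfolding quad_obj_def d_def[symmetric] generalized_eigenbasis_quadratic_form(1)[OF e] c_def
    by (rule sum_distrib_left)
  \<comment> \<open>For each argument of \<open>min\<close> the corresponding estimate holds in
    every direction, so it survives summation over \<open>i\<close>.\<close>
  have "(\<Sum>i\<in>UNIV. variance_part k i)
      \<le> min (1 / (2 * real (k + 1)) * trace (matrix_inv H ** \<Sigma>g))
          (\<alpha> / 4 * trace (matrix_inv (B - (\<alpha> / 2) *\<^sub>R H) ** \<Sigma>g))"
    unfolding tr1 tr2 sum_distrib_left Suc_eq_plus1[symmetric]
    by (intro min.boundedI sum_mono variance_part_le_averaged variance_part_le_stationary)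
  moreover have "(\<Sum>i\<in>UNIV. bias_part k i)
      \<le> min (1 / (2 * (real (k + 1))\<^sup>2 * \<alpha>\<^sup>2) *
               (norm (matrix_inv (matrix_sqrt H) *v (B *v (\<theta>0 - \<theta>s))))\<^sup>2)
          (min (1 / (2 * real (k + 1) * \<alpha>) * (norm (matrix_sqrt B *v (\<theta>0 - \<theta>s)))\<^sup>2)
               (quad_obj H \<theta>s \<theta>0))"
    unfolding d_def[symmetric] h0 nB nH sum_distrib_left Suc_eq_plus1[symmetric]
    unfolding c_def d_def
    by (intro min.boundedI sum_mono bias_part_le)
  moreover have "quad_obj H \<theta>s \<theta>s = 0" by (simp add: quad_obj_def)
  ultimately show ?thesis
    unfolding expectation_quad_obj_iterate_avg by linarith
qed

end
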